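(* Let $0<q<1$, $n\ge1$, and let $a,b\ge0$ and $m\ge1$ be integers. Then \[ \sum_{T\in\mathrm{RPP}(n^n)}\mathrm{wt}_{a,b,m}(T)=\frac{q^{(-1-a)\binom n2-2\binom n3}}{(1-q)^n\prod_{j=1}^{n-1}(q;q)_j^2}\;S, \] where \[ S=\int_{0\le x_1\le\cdots\le x_n\le1}\prod_{i=1}^nx_i^{a}(qx_i;q)_{b}\prod_{1\le i<j\le n}x_j^{2m-1}(q^{1-m}x_i/x_j;q)_{2m-1}\,\overline\Delta(x)\,d_qx_1\cdots d_qx_n . \]
   Context: A reverse plane partition of the square shape $(n^n)$ is an $n\times n$ array of nonnegative integers weakly increasing along rows and down columns; $|T|$ is the sum of entries, $\mathrm{tr}(T)=\sum_iT(i,i)$, and $\mathrm{rdiag}(T)=(\mu_1,\dots,\mu_n)=(T(n,n),\dots,T(1,1))$. With $v_i=\mu_i+n-i$, $\mathrm{wt}_{a,b,m}(T)=q^{|T|+a\,\mathrm{tr}(T)}\prod_{i=1}^n(q^{v_i+1};q)_b\prod_{1\le i<j\le n}\frac{(q^{v_j})^{2m-1}(q^{1-m+v_i-v_j};q)_{2m-1}}{q^{v_j}-q^{v_i}}$. Here $(y;q)_k=\prod_{l=0}^{k-1}(1-yq^l)$, $x_j^{2m-1}(q^{1-m}x_i/x_j;q)_{2m-1}$ means $\prod_{l=0}^{2m-2}(x_j-q^{1-m+l}x_i)$, and $\overline\Delta(x)=\prod_{i<j}(x_j-x_i)$. For $0<q<1$, $\int_a^b g\,d_qx=(1-q)\sum_{i\ge0}(g(bq^i)bq^i-g(aq^i)aq^i)$,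 and the integral over $\{0\le x_1\le\cdots\le x_n\le1\}$ is $\int_0^1\int_0^{x_n}\cdots\int_0^{x_2}(\cdot)\,d_qx_1\cdots d_qx_n$. *)

theory Defs
  imports "HOL-Analysis.Analysis"
begin

definition qpoch :: "real \<Rightarrow> real \<Rightarrow> nat \<Rightarrow> real" where
  "qpoch q y k = (\<Prod>l<k. 1 - y * q ^ l)"

text \<open>Arrays are indexed by \<open>1, \<dots>, n\<close> in both arguments and are zero outside that range, so that
  each array is represented by exactly one function.\<close>

definition RPP :: "nat \<Rightarrow> (nat \<Rightarrow> nat \<Rightarrow> nat) set" where
  "RPP n = {T.
     (\<forall>i j. \<not> (i \<in> {1..n} \<and> j \<in> {1..n}) \<longrightarrow> T i j = 0) \<and>
     (\<forall>i\<in>{1..n}. mono_on {1..n} (\<lambda>j. T i j)) \<and>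
     (\<forall>j\<in>{1..n}. mono_on {1..n} (\<lambda>i. T i j))}"

definition rpp_size :: "nat \<Rightarrow> (nat \<Rightarrow> nat \<Rightarrow> nat) \<Rightarrow> nat" where
  "rpp_size n T = (\<Sum>i=1..n. \<Sum>j=1..n. T i j)"

definition rpp_trace :: "nat \<Rightarrow> (nat \<Rightarrow> nat \<Rightarrow> nat) \<Rightarrow> nat" where
  "rpp_trace n T = (\<Sum>i=1..n. T i i)"

definition rdiag :: "nat \<Rightarrow> (nat \<Rightarrow> nat \<Rightarrow> nat) \<Rightarrow> nat \<Rightarrow> nat" where
  "rdiag n T i = T (n + 1 - i) (n + 1 - i)"

definition vdiag :: "nat \<Rightarrow> (nat \<Rightarrow> nat \<Rightarrow> nat) \<Rightarrow> nat \<Rightarrow> nat" where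
  "vdiag n T i = rdiag n T i + (n - i)"

text \<open>The exponent \<open>1 - m + v\<^sub>i - v\<^sub>j\<close> may be negative, hence the integer power.\<close>

definition rpp_wt ::
  "real \<Rightarrow> nat \<Rightarrow> nat \<Rightarrow> nat \<Rightarrow> nat \<Rightarrow> (nat \<Rightarrow> nat \<Rightarrow> nat) \<Rightarrow> real" where
  "rpp_wt q n a b m T =
     (let v = vdiag n T in
      q ^ (rpp_size n T + a * rpp_trace n T) *
      (\<Prod>i=1..n. qpoch q (q ^ (v i + 1)) b) *
      (\<Prod>i=1..n. \<Prod>j\<in>{i<..n}.
         (q ^ v j) ^ (2 * m - 1) *
         qpoch q (q powi (1 - int m + int (v i) - int (v j))) (2 * m - 1) /
         (q ^ v j - q ^ v i)))"

definition jackson_integral :: "real \<Rightarrow> real \<Rightarrow> real \<Rightarrow> (real \<Rightarrow> real) \<Rightarrow> real" where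
  "jackson_integral q a b g =
     (1 - q) * (\<Sum>i. g (b * q ^ i) * (b * q ^ i) - g (a * q ^ i) * (a * q ^ i))"

text \<open>\<open>jackson_simplex q n c f\<close> is the iterated integral over
  \<open>0 \<le> x\<^sub>1 \<le> \<dots> \<le> x\<^sub>n \<le> c\<close> with \<open>x\<^sub>n\<close> as outermost variable;
  the point \<open>(x\<^sub>1, \<dots>, x\<^sub>n)\<close> is passed to \<open>f\<close> as a function on the
  indices \<open>1, \<dots>, n\<close> that is zero elsewhere.\<close>

primrec jackson_simplex :: "real \<Rightarrow> nat \<Rightarrow> real \<Rightarrow> ((nat \<Rightarrow> real) \<Rightarrow> real) \<Rightarrow> real" where
  "jackson_simplex q 0 c f = f (\<lambda>_. 0)"
| "jackson_simplex q (Suc k) c f =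
     jackson_integral q 0 c (\<lambda>t. jackson_simplex q k t (\<lambda>x. f (x(Suc k := t))))"

text \<open>The homogenised form \<open>y\<^bsup>2m-1\<^esup> (q\<^bsup>1-m\<^esup> x / y; q)\<^bsub>2m-1\<^esub>\<close>, defined for \<open>y = 0\<close> as well.\<close>

definition hom_qpoch :: "real \<Rightarrow> nat \<Rightarrow> real \<Rightarrow> real \<Rightarrow> real" where
  "hom_qpoch q m x y = (\<Prod>l<2 * m - 1. y - q powi (1 - int m + int l) * x)"

definition Delta_bar :: "nat \<Rightarrow> (nat \<Rightarrow> real) \<Rightarrow> real" where
  "Delta_bar n x = (\<Prod>i=1..n. \<Prod>j\<in>{i<..n}. x j - x i)"

definition selberg_integrand ::
  "real \<Rightarrow> nat \<Rightarrow> nat \<Rightarrow> nat \<Rightarrow> nat \<Rightarrow> (nat \<Rightarrow> real) \<Rightarrow> real" where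
  "selberg_integrand q n a b m x =
     (\<Prod>i=1..n. x i ^ a * qpoch q (q * x i) b) *
     (\<Prod>i=1..n. \<Prod>j\<in>{i<..n}. hom_qpoch q m (x i) (x j)) *
     Delta_bar n x"

end

theory Submission
  imports Defs "Jordan_Normal_Form.Determinant"
begin

text \<open>
  Cutting an array along its main diagonal leaves two triangular arrays, i.e. two Gelfand--Tsetlin
  patterns with the diagonal as top row.  Their generating function is a quotient of two Vandermonde
  products: summing the Vandermonde determinant over all sequences interlacing \<open>u\<close> amounts to summing
  each row separately, which turns its rows into differences of consecutive rows of the next larger
  Vandermonde matrix.  Hence the arrays with a given diagonal contribute the square of
  \<open>Delta_bar\<close> at \<open>x\<^sub>i = q\<^bsup>v\<^sub>i\<^esup>\<close>, up to constants; one factor cancels the denominator of the weight, and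
  the remaining sum over the diagonal is the Jackson integral, whose integrand vanishes unless
  \<open>v\<close> is strictly decreasing.
\<close>

subsection \<open>Vandermonde determinants\<close>

definition vandermonde :: "nat \<Rightarrow> (nat \<Rightarrow> 'a::comm_ring_1) \<Rightarrow> 'a" where
  "vandermonde n y = (\<Prod>i<n. \<Prod>j\<in>{i<..<n}. y j - y i)"

lemma vandermonde_Suc:
  "vandermonde (Suc n) y = (\<Prod>j<n. y (Suc j) - y 0) * vandermonde n (\<lambda>i. y (Suc i))"
proof -
  have 0: "{0<..<Suc n} = Suc ` {..<n}"
    by (auto simp: image_iff gr0_conv_Suc)
  have S: "{Suc i<..<Suc n} = Suc ` {i<..<n}" for i
    using Suc_less_eq2 by force
  show ?thesis
    unfolding vandermonde_def prod.lessThan_Suc_shift 0 S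
    by (simp add: prod.reindex)
qed

section \<open>Determinant identities: scaling, multilinearity, expansion and row operations\<close>

lemma det_transpose_entries:
  fixes g :: "nat \<Rightarrow> nat \<Rightarrow> 'a::comm_ring_1"
  shows "det (mat k k (\<lambda>(i,j). g i j)) = det (mat k k (\<lambda>(i,j). g j i))"
proof -
  have "transpose_mat (mat k k (\<lambda>(i,j). g i j)) = mat k k (\<lambda>(i,j). g j i)"
    by (intro eq_matI) auto
  then show ?thesis
    using det_transpose[of "mat k k (\<lambda>(i,j). g i j)" k] by simp
qed

lemma det_scale_rows:
  fixes f :: "nat \<Rightarrow> nat \<Rightarrow> 'a::comm_ring_1"
  shows "det (mat n n (\<lambda>(i,j). c i * f i j)) = (\<Prod>i<n. c i) * det (mat n n (\<lambda>(i,j). f i j))"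
  by (subst (1 2) det_def'[where n = n])
     (auto simp: sum_distrib_left prod.distrib atLeast0LessThan permutes_in_image mult_ac intro!: sum.cong)

lemma det_scale_columns:
  fixes f :: "nat \<Rightarrow> nat \<Rightarrow> 'a::comm_ring_1"
  shows "det (mat n n (\<lambda>(i,j). c j * f i j)) = (\<Prod>j<n. c j) * det (mat n n (\<lambda>(i,j). f i j))"
  by (subst (1 2) det_transpose_entries) (rule det_scale_rows)

text \<open>Multilinearity in the rows: each Leibniz product of sums expands into a sum over choice
  functions, and the two finite sums are interchanged. Independent summations, one per row, can thus
  be carried out inside the determinant.\<close>

lemma det_sum_rows:
  fixes f :: "nat \<Rightarrow> 'b \<Rightarrow> nat \<Rightarrow> 'a::comm_ring_1"
  assumes "\<And>i. i < n \<Longrightarrow> finite (S i)"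
  shows "det (mat n n (\<lambda>(i,j). \<Sum>k\<in>S i. f i k j))
       = (\<Sum>w\<in>PiE {..<n} S. det (mat n n (\<lambda>(i,j). f i (w i) j)))"
proof -
  have "det (mat n n (\<lambda>(i,j). \<Sum>k\<in>S i. f i k j))
      = (\<Sum>p | p permutes {..<n}. signof p * (\<Prod>i<n. \<Sum>k\<in>S i. f i k (p i)))"
    by (subst det_def'[where n = n]) (auto simp: atLeast0LessThan permutes_in_image intro!: sum.cong)
  also have "\<dots> = (\<Sum>p | p permutes {..<n}. \<Sum>w\<in>PiE {..<n} S. signof p * (\<Prod>i<n. f i (w i) (p i)))"
    using assms by (subst prod_sum_PiE) (auto simp: sum_distrib_left)
  also have "\<dots> = (\<Sum>w\<in>PiE {..<n} S. \<Sum>p | p permutes {..<n}. signof p * (\<Prod>i<n. f i (w i) (p i)))"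
    by (rule sum.swap)
  also have "\<dots> = (\<Sum>w\<in>PiE {..<n} S. det (mat n n (\<lambda>(i,j). f i (w i) j)))"
    by (subst det_def'[where n = n]) (auto simp: atLeast0LessThan permutes_in_image intro!: sum.cong)
  finally show ?thesis .
qed

lemma det_expand_unit_row:
  fixes f :: "nat \<Rightarrow> nat \<Rightarrow> 'a::comm_ring_1"
  assumes "f 0 0 = 1" "\<And>j. j < n \<Longrightarrow> f 0 (Suc j) = 0"
  shows "det (mat (Suc n) (Suc n) (\<lambda>(i,j). f i j)) = det (mat n n (\<lambda>(i,j). f (Suc i) (Suc j)))"
proof -
  let ?M = "mat (Suc n) (Suc n) (\<lambda>(i,j). f i j)"
  have "det ?M = (\<Sum>j<Suc n. ?M $$ (0,j) * cofactor ?M 0 j)"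
    by (rule laplace_expansion_row) auto
  also have "\<dots> = cofactor ?M 0 0"
    by (subst sum.lessThan_Suc_shift) (simp add: assms)
  also have "\<dots> = det (mat_delete ?M 0 0)"
    by (simp add: cofactor_def)
  also have "mat_delete ?M 0 0 = mat n n (\<lambda>(i,j). f (Suc i) (Suc j))"
    by (intro eq_matI) (auto simp: mat_delete_def)
  finally show ?thesis .
qed

lemma det_expand_unit_column:
  fixes f :: "nat \<Rightarrow> nat \<Rightarrow> 'a::comm_ring_1"
  assumes "f 0 0 = 1" "\<And>i. i < n \<Longrightarrow> f (Suc i) 0 = 0"
  shows "det (mat (Suc n) (Suc n) (\<lambda>(i,j). f i j)) = det (mat n n (\<lambda>(i,j). f (Suc i) (Suc j)))"
  by (subst (1 2) det_transpose_entries) (rule det_expand_unit_row, use assms in auto)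

text \<open>Every row loses a multiple of the original row above it, all at once. This is left
  multiplication by a lower bidiagonal matrix with unit diagonal, whose determinant is 1.\<close>

lemma det_subtract_rows:
  fixes f :: "nat \<Rightarrow> nat \<Rightarrow> 'a::comm_ring_1"
  shows "det (mat n n (\<lambda>(i,j). f i j - (if i = 0 then 0 else c * f (i - 1) j)))
       = det (mat n n (\<lambda>(i,j). f i j))"
proof -
  define P where "P = mat n n (\<lambda>(i,k). if k = i then 1 else if Suc k = i then - c else 0 :: 'a)"
  have "det P = prod_list (diag_mat P)"
    by (rule det_lower_triangular[where n = n]) (auto simp: P_def)
  also have "diag_mat P = map (\<lambda>i. 1) [0..<n]"
    by (auto simp: diag_mat_def P_def)
  finally have P: "det P = 1"
    by (simp add: map_replicate_const)
  have "P * mat n n (\<lambda>(i,j). f i j) = mat n n (\<lambda>(i,j). f i j - (if i = 0 then 0 else c * f (i - 1) j))"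
  proof (intro eq_matI)
    fix i j assume ij: "i < dim_row (mat n n (\<lambda>(i,j). f i j - (if i = 0 then 0 else c * f (i - 1) j)))"
      "j < dim_col (mat n n (\<lambda>(i,j). f i j - (if i = 0 then 0 else c * f (i - 1) j)))"
    have "(P * mat n n (\<lambda>(i,j). f i j)) $$ (i,j) = (\<Sum>k\<in>{0..<n}. P $$ (i,k) * f k j)"
      using ij by (auto simp: P_def scalar_prod_def intro!: sum.cong)
    also have "\<dots> = (\<Sum>k\<in>{0..<n}. (if k = i then f k j else 0) - (if Suc k = i then c * f k j else 0))"
      using ij by (auto simp: P_def intro!: sum.cong)
    also have "\<dots> = f i j - (\<Sum>k\<in>{0..<n}. if Suc k = i then c * f k j else 0)"
      using ij by (simp add: sum_subtractf sum.delta)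
    also have "(\<Sum>k\<in>{0..<n}. if Suc k = i then c * f k j else 0) = (if i = 0 then 0 else c * f (i - 1) j)"
    proof (cases i)
      case (Suc i')
      then have "(\<Sum>k\<in>{0..<n}. if Suc k = i then c * f k j else 0) = (\<Sum>k\<in>{0..<n}. if k = i' then c * f k j else 0)"
        by (intro sum.cong) auto
      then show ?thesis using ij Suc by (simp add: sum.delta)
    qed simp
    finally show "(P * mat n n (\<lambda>(i,j). f i j)) $$ (i,j)
        = mat n n (\<lambda>(i,j). f i j - (if i = 0 then 0 else c * f (i - 1) j)) $$ (i,j)"
      using ij by simp
  qed (auto simp: P_def)
  moreover have "det (P * mat n n (\<lambda>(i,j). f i j)) = det P * det (mat n n (\<lambda>(i,j). f i j))"
    by (rule det_mult[of _ n]) (auto simp: P_def)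
  ultimately show ?thesis using P by simp
qed

text \<open>After transposition, subtracting \<open>y 0\<close> times the row above clears the
  column of \<open>y 0\<close> below its top entry 1. Each remaining column \<open>i\<close> then
  has the common factor \<open>y (Suc i) - y 0\<close>, as in
  \<open>vandermonde_Suc\<close>.\<close>

lemma det_vandermonde:
  fixes y :: "nat \<Rightarrow> 'a::comm_ring_1"
  shows "det (mat n n (\<lambda>(i,j). y i ^ j)) = vandermonde n y"
proof (induction n arbitrary: y)
  case 0
  then show ?case by (simp add: vandermonde_def)
next
  case (Suc n)
  have "det (mat (Suc n) (Suc n) (\<lambda>(i,j). y i ^ j)) = det (mat (Suc n) (Suc n) (\<lambda>(j,i). y i ^ j))"
    by (rule det_transpose_entries)
  also have "\<dots> = det (mat (Suc n) (Suc n) (\<lambda>(j,i). y i ^ j - (if j = 0 then 0 else y 0 * y i ^ (j - 1))))"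
    by (rule det_subtract_rows[symmetric])
  also have "\<dots> = det (mat n n (\<lambda>(j,i). y (Suc i) ^ Suc j - (if Suc j = 0 then 0 else y 0 * y (Suc i) ^ (Suc j - 1))))"
    by (rule det_expand_unit_column) auto
  also have "\<dots> = det (mat n n (\<lambda>(j,i). (y (Suc i) - y 0) * y (Suc i) ^ j))"
    by (simp add: algebra_simps)
  also have "\<dots> = (\<Prod>i<n. y (Suc i) - y 0) * det (mat n n (\<lambda>(j,i). y (Suc i) ^ j))"
    by (rule det_scale_columns)
  also have "det (mat n n (\<lambda>(j,i). y (Suc i) ^ j)) = det (mat n n (\<lambda>(i,j). y (Suc i) ^ j))"
    by (rule det_transpose_entries)
  finally show ?case
    by (simp add: Suc.IH vandermonde_Suc)
qed

text \<open>Subtracting consecutive rows clears the column of zeroth powers, so the exponents of the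
  smaller matrix start at 1. Its entries have the shape that geometric sums over intervals
  produce.\<close>

lemma vandermonde_eq_det_differences:
  fixes y :: "nat \<Rightarrow> 'a::comm_ring_1"
  shows "vandermonde (Suc n) y = det (mat n n (\<lambda>(i,j). y (Suc i) ^ Suc j - y i ^ Suc j))"
proof -
  have "vandermonde (Suc n) y
      = det (mat (Suc n) (Suc n) (\<lambda>(i,j). y i ^ j - (if i = 0 then 0 else 1 * y (i - 1) ^ j)))"
    unfolding det_vandermonde[symmetric] by (rule det_subtract_rows[symmetric])
  also have "\<dots> = det (mat n n (\<lambda>(i,j). y (Suc i) ^ Suc j - (if Suc i = 0 then 0 else 1 * y (Suc i - 1) ^ Suc j)))"
    by (rule det_expand_unit_column) auto
  finally show ?thesis by simp
qed

lemma sum_power_interval: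
  fixes x :: "'a::field"
  assumes "a \<le> b" "x \<noteq> 1"
  shows "(\<Sum>k\<in>{a..<b}. x ^ k) = (x ^ a - x ^ b) / (1 - x)"
proof -
  have "(\<Sum>k\<in>{a..<b}. x ^ k) * (1 - x) = x ^ a - x ^ b"
    using assms(1)
  proof (induction b rule: dec_induct)
    case (step k)
    have "(\<Sum>k\<in>{a..<Suc k}. x ^ k) * (1 - x) = (\<Sum>k\<in>{a..<k}. x ^ k) * (1 - x) + x ^ k * (1 - x)"
      using step.hyps by (simp only: sum.atLeastLessThan_Suc[OF step.hyps(1)] distrib_right)
    then show ?case
      unfolding step.IH by (simp add: left_diff_distrib right_diff_distrib mult.commute)
  qed simp
  with assms(2) show ?thesis
    by (simp add: eq_divide_eq)
qed

text \<open>The factor \<open>q ^ w i\<close> raises the exponents in row \<open>i\<close> by one,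
  so the entry in column \<open>j\<close> is a power of \<open>q ^ Suc j\<close>, a ratio different
  from 1. Summing it over the interval gives a difference of two consecutive Vandermonde entries
  times \<open>- 1 / (1 - q ^ Suc j)\<close>; these column constants multiply to the sign and
  \<open>qpoch q q n\<close>.\<close>

lemma sum_interlacing_vandermonde:
  fixes q :: real
  assumes q: "0 < q" "q < 1" and u: "\<And>i. i < n \<Longrightarrow> u i \<le> u (Suc i)"
  shows "(\<Sum>w\<in>PiE {..<n} (\<lambda>i. {u i..<u (Suc i)}). (\<Prod>i<n. q ^ w i) * vandermonde n (\<lambda>i. q ^ w i))
       = (-1) ^ n * vandermonde (Suc n) (\<lambda>i. q ^ u i) / qpoch q q n"
proof -
  have q1: "q ^ Suc j \<noteq> 1" for j
    using q power_Suc_less_one[of q j] by simp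
  have pc: "(q ^ Suc j) ^ k = (q ^ k) ^ Suc j" for j k
    by (metis power_mult mult.commute)
  have neg_div: "(x - y) / z = (- 1 / z) * (y - x)" for x y z :: real
    by (cases "z = 0") (simp_all add: field_simps)
  have "(\<Sum>w\<in>PiE {..<n} (\<lambda>i. {u i..<u (Suc i)}). (\<Prod>i<n. q ^ w i) * vandermonde n (\<lambda>i. q ^ w i))
      = (\<Sum>w\<in>PiE {..<n} (\<lambda>i. {u i..<u (Suc i)}). det (mat n n (\<lambda>(i,j). (q ^ Suc j) ^ w i)))"
    unfolding det_vandermonde[symmetric] det_scale_rows[symmetric]
    by (simp add: power_mult[symmetric] algebra_simps power_add)
  also have "\<dots> = det (mat n n (\<lambda>(i,j). \<Sum>k\<in>{u i..<u (Suc i)}. (q ^ Suc j) ^ k))"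
    by (rule det_sum_rows[symmetric]) auto
  also have "mat n n (\<lambda>(i,j). \<Sum>k\<in>{u i..<u (Suc i)}. (q ^ Suc j) ^ k)
      = mat n n (\<lambda>(i,j). (- 1 / (1 - q ^ Suc j)) * ((q ^ u (Suc i)) ^ Suc j - (q ^ u i) ^ Suc j))"
  proof (intro eq_matI)
    fix i j
    assume "i < dim_row (mat n n (\<lambda>(i,j). (- 1 / (1 - q ^ Suc j)) * ((q ^ u (Suc i)) ^ Suc j - (q ^ u i) ^ Suc j)))"
      "j < dim_col (mat n n (\<lambda>(i,j). (- 1 / (1 - q ^ Suc j)) * ((q ^ u (Suc i)) ^ Suc j - (q ^ u i) ^ Suc j)))"
    then have ij: "i < n" "j < n" by auto
    have "(\<Sum>k\<in>{u i..<u (Suc i)}. (q ^ Suc j) ^ k) = ((q ^ Suc j) ^ u i - (q ^ Suc j) ^ u (Suc i)) / (1 - q ^ Suc j)"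
      using u[OF ij(1)] q1 by (rule sum_power_interval)
    also have "\<dots> = (- 1 / (1 - q ^ Suc j)) * ((q ^ u (Suc i)) ^ Suc j - (q ^ u i) ^ Suc j)"
      unfolding pc neg_div ..
    finally show "mat n n (\<lambda>(i,j). \<Sum>k\<in>{u i..<u (Suc i)}. (q ^ Suc j) ^ k) $$ (i,j)
        = mat n n (\<lambda>(i,j). (- 1 / (1 - q ^ Suc j)) * ((q ^ u (Suc i)) ^ Suc j - (q ^ u i) ^ Suc j)) $$ (i,j)"
      using ij by simp
  qed auto
  also have "det \<dots> = (\<Prod>j<n. - 1 / (1 - q ^ Suc j)) * vandermonde (Suc n) (\<lambda>i. q ^ u i)"
    unfolding vandermonde_eq_det_differences by (rule det_scale_columns)
  also have "(\<Prod>j<n. - 1 / (1 - q ^ Suc j)) = (-1) ^ n / qpoch q q n"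
    unfolding prod_dividef qpoch_def by simp
  finally show ?thesis by simp
qed

subsection \<open>Triangular arrays and arrays with a given diagonal\<close>

text \<open>Triangles are indexed from \<open>0\<close>, unlike \<open>RPP\<close>, to match matrix indices; \<open>d\<close> prescribes the
  diagonal, which \<open>triangle_size\<close> does not count.\<close>

definition triangles :: "nat \<Rightarrow> (nat \<Rightarrow> nat) \<Rightarrow> (nat \<Rightarrow> nat \<Rightarrow> nat) set" where
  "triangles n d = {T.
     (\<forall>i j. \<not> (j \<le> i \<and> i < n) \<longrightarrow> T i j = 0) \<and>
     (\<forall>i<n. T i i = d i) \<and>
     (\<forall>i j. j < i \<and> i < n \<longrightarrow> T i j \<le> T i (Suc j)) \<and>
     (\<forall>i j. j \<le> i \<and> Suc i < n \<longrightarrow> T i j \<le> T (Suc i) j)}"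

definition triangle_size :: "nat \<Rightarrow> (nat \<Rightarrow> nat \<Rightarrow> nat) \<Rightarrow> nat" where
  "triangle_size n T = (\<Sum>i<n. \<Sum>j<i. T i j)"

lemma triangle_size_Suc:
  "triangle_size (Suc n) T = (\<Sum>i<n. T (Suc i) i) + (\<Sum>i<n. \<Sum>j<i. T (Suc i) j)"
  unfolding triangle_size_def by (subst sum.lessThan_Suc_shift) (simp add: sum.distrib)

text \<open>Deleting the diagonal of a triangle leaves a smaller triangle whose diagonal is the
  former subdiagonal. The monotonicity conditions at the deleted entries say exactly that this
  subdiagonal interlaces \<open>d\<close>. \<open>restrict\<close> makes it a canonical element of
  the function space.\<close>

lemma bij_betw_triangles_Suc:
  "bij_betw (\<lambda>T. (restrict (\<lambda>i. T (Suc i) i) {..<n}, \<lambda>i j. if j \<le> i \<and> i < n then T (Suc i) j else 0))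
     (triangles (Suc n) d) (SIGMA e:PiE {..<n} (\<lambda>i. {d i..d (Suc i)}). triangles n e)"
  (is "bij_betw ?f ?A ?B")
proof (rule bij_betw_byWitness[where f' = "\<lambda>(e, T) i j. if i < Suc n \<and> j = i then d i
      else if j < i \<and> i < Suc n then T (i - 1) j else 0"])
  let ?g = "\<lambda>(e, T) i j. if i < Suc n \<and> j = i then d i
      else if j < i \<and> i < Suc n then T (i - 1) j else 0"
  show "\<forall>T\<in>?A. ?g (?f T) = T"
    by (auto simp: triangles_def fun_eq_iff)
  show "\<forall>p\<in>?B. ?f (?g p) = p"
  proof (intro ballI)
    fix p
    assume "p \<in> ?B"
    then obtain e T where p: "p = (e, T)"
        "e \<in> (\<Pi>\<^sub>E i\<in>{..<n}. {d i..d (Suc i)})" "T \<in> triangles n e"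
      by blast
    show "?f (?g p) = p"
      unfolding p(1) using p(2,3)
      by (intro prod_eqI) (auto simp: fun_eq_iff triangles_def restrict_def PiE_def extensional_def)
  qed
  show "?f ` ?A \<subseteq> ?B"
  proof (rule image_subsetI)
    fix T assume T: "T \<in> ?A"
    have "d i \<le> T (Suc i) i" "T (Suc i) i \<le> d (Suc i)" if "i < n" for i
    proof -
      have "T i i = d i" "T (Suc i) (Suc i) = d (Suc i)" "T i i \<le> T (Suc i) i"
        "T (Suc i) i \<le> T (Suc i) (Suc i)"
        using T that less_SucI[OF that] Suc_less_eq[of i n] lessI[of i] unfolding triangles_def mem_Collect_eq
        by blast+
      then show "d i \<le> T (Suc i) i" "T (Suc i) i \<le> d (Suc i)" by simp_all
    qed
    then have "restrict (\<lambda>i. T (Suc i) i) {..<n} \<in> PiE {..<n} (\<lambda>i. {d i..d (Suc i)})"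
      by (simp add: PiE_iff)
    moreover have "(\<lambda>i j. if j \<le> i \<and> i < n then T (Suc i) j else 0)
        \<in> triangles n (restrict (\<lambda>i. T (Suc i) i) {..<n})"
      using T by (simp add: triangles_def)
    ultimately show "?f T \<in> ?B" by simp
  qed
  show "?g ` ?B \<subseteq> ?A"
  proof (rule image_subsetI)
    fix p
    assume "p \<in> ?B"
    then obtain e T where p: "p = (e, T)"
        and e: "e \<in> (\<Pi>\<^sub>E i\<in>{..<n}. {d i..d (Suc i)})" and T: "T \<in> triangles n e"
      by blast
    have e': "d i \<le> e i" "e i \<le> d (Suc i)" if "i < n" for i
      using e that by (auto simp: PiE_def Pi_def)
    have T0: "T i i = e i" if "i < n" for i
      using T that by (auto simp: triangles_def)
    have T1: "T i j \<le> T i (Suc j)" if "j < i" "i < n" for i j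
      using T that by (auto simp: triangles_def)
    have T2: "T i j \<le> T (Suc i) j" if "j \<le> i" "Suc i < n" for i j
      using T that by (auto simp: triangles_def)
    let ?T = "\<lambda>i j. if i < Suc n \<and> j = i then d i
      else if j < i \<and> i < Suc n then T (i - 1) j else 0"
    have "?T i j \<le> ?T i (Suc j)" if "j < i" "i < Suc n" for i j
    proof (cases "Suc j = i")
      case True
      with that e' T0 show ?thesis by auto
    next
      case False
      with that T1[of j "i - 1"] show ?thesis by auto
    qed
    moreover have "?T i j \<le> ?T (Suc i) j" if "j \<le> i" "Suc i < Suc n" for i j
    proof (cases "i = j")
      case True
      with that e' T0 show ?thesis by auto
    next
      case False
      with that T2[of j "i - 1"] show ?thesis by auto
    qed
    ultimately show "?g p \<in> ?A"
      unfolding p by (simp add: triangles_def)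
  qed
qed

text \<open>The case \<open>u = id\<close> of the interlacing sum: each interval
  \<open>{i..<Suc i}\<close> has one point, so the sum has a single term.\<close>

lemma vandermonde_power_Suc:
  fixes q :: real
  assumes "0 < q" "q < 1"
  shows "(\<Prod>i<n. q ^ i) * vandermonde n (\<lambda>i. q ^ i)
       = (-1) ^ n * vandermonde (Suc n) (\<lambda>i. q ^ i) / qpoch q q n"
proof -
  have "PiE {..<n} (\<lambda>i. {i..<Suc i}) = {restrict id {..<n}}"
    by (auto simp: PiE_def Pi_def extensional_def fun_eq_iff restrict_def)
  then show ?thesis
    using sum_interlacing_vandermonde[OF assms, of n id]
    by (simp add: vandermonde_def)
qed

lemma qpoch_pos:
  assumes "0 < q" "q < 1"
  shows "0 < qpoch q q n"
  unfolding qpoch_def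
proof (rule prod_pos, goal_cases)
  case (1 l)
  then show ?case using assms power_Suc_less_one[of q l] by simp
qed

text \<open>Induction by stripping diagonals: the new diagonal \<open>e\<close> contributes its own
  sum to the size, and the smaller triangle is handled by the induction hypothesis. Finiteness is
  proved alongside because splitting the double sum requires it.\<close>

lemma sum_triangles:
  fixes q :: real
  assumes q: "0 < q" "q < 1" and d: "\<And>i. Suc i < n \<Longrightarrow> d i \<le> d (Suc i)"
  shows "finite (triangles n d) \<and> (\<Sum>T\<in>triangles n d. q ^ triangle_size n T)
       = vandermonde n (\<lambda>i. q ^ (d i + i)) / vandermonde n (\<lambda>i. q ^ i)"
  using d
proof (induction n arbitrary: d)
  case 0
  have "triangles 0 d = {\<lambda>_ _. 0}"
    by (auto simp: triangles_def)
  then show ?case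
    by (simp add: triangle_size_def vandermonde_def)
next
  case (Suc n)
  let ?E = "PiE {..<n} (\<lambda>i. {d i..d (Suc i)})"
  let ?W = "PiE {..<n} (\<lambda>i. {d i + i..<d (Suc i) + Suc i})"
  let ?D = "vandermonde n (\<lambda>i. q ^ i)"
  note bij = bij_betw_triangles_Suc[of n d]
  have IH: "finite (triangles n e)"
    "(\<Sum>T\<in>triangles n e. q ^ triangle_size n T) = vandermonde n (\<lambda>i. q ^ (e i + i)) / ?D"
    if "e \<in> ?E" for e
  proof -
    have "e i \<le> e (Suc i)" if "Suc i < n" for i
    proof -
      have "e i \<le> d (Suc i)" "d (Suc i) \<le> e (Suc i)"
        using \<open>e \<in> ?E\<close> that by (auto simp: PiE_def Pi_def)
      then show ?thesis by simp
    qed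
    from Suc.IH[of e, OF this] show "finite (triangles n e)"
      "(\<Sum>T\<in>triangles n e. q ^ triangle_size n T) = vandermonde n (\<lambda>i. q ^ (e i + i)) / ?D"
      by auto
  qed
  have finE: "finite ?E"
    by (intro finite_PiE) auto
  have fin: "finite (triangles (Suc n) d)"
    using bij_betw_finite[OF bij] finE IH(1) by (auto intro!: finite_SigmaI)
  have "(\<Sum>T\<in>triangles (Suc n) d. q ^ triangle_size (Suc n) T)
      = (\<Sum>(e,T)\<in>(SIGMA e:?E. triangles n e). q ^ ((\<Sum>i<n. e i) + triangle_size n T))"
    by (subst sum.reindex_bij_betw[OF bij, symmetric])
       (auto simp: triangle_size_Suc triangle_size_def[of n] intro!: sum.cong arg_cong2[of _ _ _ _ "(+)"])
  also have "\<dots> = (\<Sum>e\<in>?E. \<Sum>T\<in>triangles n e. q ^ ((\<Sum>i<n. e i) + triangle_size n T))"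
    by (rule sum.Sigma[symmetric]) (use finE IH in auto)
  also have "\<dots> = (\<Sum>e\<in>?E. q ^ (\<Sum>i<n. e i) * (vandermonde n (\<lambda>i. q ^ (e i + i)) / ?D))"
    by (rule sum.cong) (simp_all add: power_add sum_distrib_left[symmetric] IH)
  \<comment> \<open>The shift \<open>w i = e i + i\<close> turns the weak inequalities into
    half-open intervals, as the interlacing sum requires. It also multiplies
    \<open>q ^ (\<Sum>i<n. e i)\<close> by \<open>\<Prod>i<n. q ^ i\<close>, which is compensated in
    the denominator.\<close>
  also have "\<dots> = (\<Sum>w\<in>?W. (\<Prod>i<n. q ^ w i) * vandermonde n (\<lambda>i. q ^ w i) / ((\<Prod>i<n. q ^ i) * ?D))"
  proof (rule sum.reindex_bij_witness[where j = "\<lambda>e. restrict (\<lambda>i. e i + i) {..<n}"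
        and i = "\<lambda>w. restrict (\<lambda>i. w i - i) {..<n}"], goal_cases)
    case (1 e)
    then show ?case by (auto simp: fun_eq_iff PiE_def extensional_def)
  next
    case (2 e)
    then show ?case by (auto simp: PiE_iff less_Suc_eq_le)
  next
    case (3 w)
    then have w: "d i + i \<le> w i" if "i < n" for i
      using that by (auto simp: PiE_iff)
    have "w i - i + i = w i" if "i < n" for i
      using w[OF that] by simp
    with 3 show ?case by (auto simp: fun_eq_iff PiE_def extensional_def)
  next
    case (4 w)
    then have w: "d i + i \<le> w i \<and> w i < d (Suc i) + Suc i" if "i < n" for i
      using that by (auto simp: PiE_iff)
    have "d i \<le> w i - i \<and> w i - i \<le> d (Suc i)" if "i < n" for i
      using w[OF that] by linarith
    then show ?case by (auto simp: PiE_iff)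
  next
    case (5 e)
    have "vandermonde n (\<lambda>i. q ^ restrict (\<lambda>i. e i + i) {..<n} i) = vandermonde n (\<lambda>i. q ^ (e i + i))"
      unfolding vandermonde_def by (intro prod.cong) auto
    moreover have "(\<Prod>i<n. q ^ restrict (\<lambda>i. e i + i) {..<n} i) = q ^ (\<Sum>i<n. e i) * (\<Prod>i<n. q ^ i)"
      by (simp add: power_sum power_add prod.distrib)
    moreover have "(\<Prod>i<n. q ^ i) \<noteq> 0"
      using q by simp
    ultimately show ?case using q by simp
  qed
  also have "\<dots> = (\<Sum>w\<in>?W. (\<Prod>i<n. q ^ w i) * vandermonde n (\<lambda>i. q ^ w i)) / ((\<Prod>i<n. q ^ i) * ?D)"
    by (simp add: sum_divide_distrib)
  also have "(\<Sum>w\<in>?W. (\<Prod>i<n. q ^ w i) * vandermonde n (\<lambda>i. q ^ w i))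
      = (-1) ^ n * vandermonde (Suc n) (\<lambda>i. q ^ (d i + i)) / qpoch q q n"
    by (rule sum_interlacing_vandermonde[OF q]) (use Suc.prems in \<open>simp add: le_SucI\<close>)
  \<comment> \<open>The normalising denominator obeys the same recursion, so the sign and
    \<open>qpoch q q n\<close> cancel and no closed form is needed here.\<close>
  also have "(\<Prod>i<n. q ^ i) * ?D = (-1) ^ n * vandermonde (Suc n) (\<lambda>i. q ^ i) / qpoch q q n"
    by (rule vandermonde_power_Suc[OF q])
  also have "(-1) ^ n * vandermonde (Suc n) (\<lambda>i. q ^ (d i + i)) / qpoch q q n
      / ((-1) ^ n * vandermonde (Suc n) (\<lambda>i. q ^ i) / qpoch q q n)
      = vandermonde (Suc n) (\<lambda>i. q ^ (d i + i)) / vandermonde (Suc n) (\<lambda>i. q ^ i)"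
    using qpoch_pos[OF q, of n] by simp
  finally show ?case using fin by blast
qed

section \<open>Square arrays with a prescribed diagonal\<close>

lemma mono_on_atLeastAtMostI:
  fixes f :: "nat \<Rightarrow> 'a::order"
  assumes "\<And>j. 1 \<le> j \<Longrightarrow> j < n \<Longrightarrow> f j \<le> f (Suc j)"
  shows "mono_on {1..n} f"
proof (rule mono_onI)
  fix r s assume rs: "r \<in> {1..n}" "s \<in> {1..n}" "r \<le> s"
  from rs(3) rs(2) show "f r \<le> f s"
  proof (induction s rule: dec_induct)
    case (step s)
    then have "f r \<le> f s" using rs(1) by auto
    also have "f s \<le> f (Suc s)" using step rs(1) assms by auto
    finally show ?case .
  qed simp
qed

definition RPP_diag :: "nat \<Rightarrow> (nat \<Rightarrow> nat) \<Rightarrow> (nat \<Rightarrow> nat \<Rightarrow> nat) set" where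
  "RPP_diag n d = {T \<in> RPP n. \<forall>i<n. T (Suc i) (Suc i) = d i}"

text \<open>The part on and below the diagonal is a triangle as it stands, the part on and above it
  after transposition. The two share only the diagonal, so any two triangles with equal diagonals
  can be glued.\<close>

lemma bij_betw_RPP_diag:
  "bij_betw (\<lambda>T. (\<lambda>i j. if j \<le> i \<and> i < n then T (Suc i) (Suc j) else 0,
                 \<lambda>i j. if j \<le> i \<and> i < n then T (Suc j) (Suc i) else 0))
     (RPP_diag n d) (triangles n d \<times> triangles n d)"
  (is "bij_betw ?f ?A ?B")
proof (rule bij_betw_byWitness[where f' = "\<lambda>(L, U) i j. if i \<in> {1..n} \<and> j \<in> {1..n} then
      if j \<le> i then L (i - 1) (j - 1) else U (j - 1) (i - 1) else 0"])
  let ?g = "\<lambda>(L, U) i j. if i \<in> {1..n} \<and> j \<in> {1..n} then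
      if j \<le> i then L (i - 1) (j - 1) else U (j - 1) (i - 1) else (0::nat)"
  show "\<forall>T\<in>?A. ?g (?f T) = T"
  proof (intro ballI ext)
    fix T i j assume "T \<in> ?A"
    then show "?g (?f T) i j = T i j"
      by (cases i; cases j) (auto simp: RPP_diag_def RPP_def)
  qed
  show "\<forall>p\<in>?B. ?f (?g p) = p"
    by (fastforce simp: triangles_def fun_eq_iff)
  show "?f ` ?A \<subseteq> ?B"
  proof (rule image_subsetI)
    fix T assume T: "T \<in> ?A"
    have r: "T i j \<le> T i j'" if "i \<in> {1..n}" "j \<in> {1..n}" "j' \<in> {1..n}" "j \<le> j'" for i j j'
      using T that by (auto simp: RPP_diag_def RPP_def mono_on_def)
    have c: "T j i \<le> T j' i" if "i \<in> {1..n}" "j \<in> {1..n}" "j' \<in> {1..n}" "j \<le> j'" for i j j'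
      using T that by (auto simp: RPP_diag_def RPP_def mono_on_def)
    show "?f T \<in> ?B"
      using T by (auto simp: triangles_def RPP_diag_def intro!: r c)
  qed
  show "?g ` ?B \<subseteq> ?A"
  proof (rule image_subsetI)
    fix p assume "p \<in> ?B"
    then obtain L U where p: "p = (L, U)" and L: "L \<in> triangles n d" and U: "U \<in> triangles n d"
      by blast
    have diag: "L i i = d i" "U i i = d i" if "i < n" for i
      using L U that by (auto simp: triangles_def)
    have r: "L i j \<le> L i (Suc j)" "U i j \<le> U i (Suc j)" if "j < i" "i < n" for i j
      using L U that by (auto simp: triangles_def)
    have c: "L i j \<le> L (Suc i) j" "U i j \<le> U (Suc i) j" if "j \<le> i" "Suc i < n" for i j
      using L U that by (auto simp: triangles_def)
    let ?T = "?g (L, U)"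
    \<comment> \<open>Only neighbouring entries need comparing. When a step meets the diagonal, at
      \<open>j = i\<close> or \<open>Suc j = i\<close>, the two triangles are linked by their common
      diagonal value.\<close>
    have step: "?T i j \<le> ?T i (Suc j) \<and> ?T j i \<le> ?T (Suc j) i" if "i \<in> {1..n}" "1 \<le> j" "j < n" for i j
    proof -
      consider "j < i" | "j = i" | "i < j" by linarith
      then show ?thesis
      proof cases
        case 1
        with that r[of "j - 1" "i - 1"] diag[of j] show ?thesis
          by (cases "i = Suc j") auto
      next
        case 2
        with that c[of "j - 1" "j - 1"] diag[of "j - 1"] show ?thesis by auto
      next
        case 3
        with that c[of "i - 1" "j - 1"] show ?thesis by auto
      qed
    qed
    have "mono_on {1..n} (?T i)" "mono_on {1..n} (\<lambda>j. ?T j i)" if "i \<in> {1..n}" for i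
      by (rule mono_on_atLeastAtMostI, use step that in blast)+
    moreover have "\<forall>i j. \<not> (i \<in> {1..n} \<and> j \<in> {1..n}) \<longrightarrow> ?T i j = 0" "\<forall>i<n. ?T (Suc i) (Suc i) = d i"
      using diag by auto
    ultimately have "?T \<in> ?A"
      unfolding RPP_diag_def RPP_def mem_Collect_eq by blast
    then show "?g p \<in> ?A"
      unfolding p .
  qed
qed

lemma sum_square_split_diagonal:
  fixes f :: "nat \<Rightarrow> nat \<Rightarrow> 'a::comm_monoid_add"
  shows "(\<Sum>i<n. \<Sum>j<n. f i j)
    = (\<Sum>i<n. f i i) + ((\<Sum>i<n. \<Sum>j<i. f i j) + (\<Sum>i<n. \<Sum>j<i. f j i))"
  by (induction n) (simp_all add: sum.distrib add_ac)

text \<open>The two triangles vary independently, so their generating functions multiply to a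
  square. The diagonal, which neither triangle size counts, gives the power in front.\<close>

lemma sum_RPP_diag:
  fixes q :: real
  assumes q: "0 < q" "q < 1" and d: "\<And>i. Suc i < n \<Longrightarrow> d i \<le> d (Suc i)"
  shows "finite (RPP_diag n d)"
    and "(\<Sum>T\<in>RPP_diag n d. q ^ rpp_size n T)
       = q ^ (\<Sum>i<n. d i) * (vandermonde n (\<lambda>i. q ^ (d i + i)) / vandermonde n (\<lambda>i. q ^ i))\<^sup>2"
proof -
  note bij = bij_betw_RPP_diag[of n d]
  have tri: "finite (triangles n d)" "(\<Sum>T\<in>triangles n d. q ^ triangle_size n T)
       = vandermonde n (\<lambda>i. q ^ (d i + i)) / vandermonde n (\<lambda>i. q ^ i)"
    using sum_triangles[of q n d, OF q d] by auto
  show "finite (RPP_diag n d)"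
    using bij_betw_finite[OF bij] tri by auto
  have size: "rpp_size n T = (\<Sum>i<n. d i) +
      (triangle_size n (\<lambda>i j. if j \<le> i \<and> i < n then T (Suc i) (Suc j) else 0) +
       triangle_size n (\<lambda>i j. if j \<le> i \<and> i < n then T (Suc j) (Suc i) else 0))"
    if "T \<in> RPP_diag n d" for T
  proof -
    have "rpp_size n T = (\<Sum>i<n. \<Sum>j<n. T (Suc i) (Suc j))"
      by (simp add: rpp_size_def sum.atLeast1_atMost_eq)
    then show ?thesis
      using that unfolding sum_square_split_diagonal triangle_size_def
      by (auto simp: RPP_diag_def intro!: sum.cong arg_cong2[of _ _ _ _ "(+)"])
  qed
  have "(\<Sum>T\<in>RPP_diag n d. q ^ rpp_size n T)
      = (\<Sum>(L,U)\<in>triangles n d \<times> triangles n d. q ^ ((\<Sum>i<n. d i) + (triangle_size n L + triangle_size n U)))"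
    by (subst sum.reindex_bij_betw[OF bij, symmetric]) (auto simp: size intro!: sum.cong)
  also have "\<dots> = q ^ (\<Sum>i<n. d i) * ((\<Sum>L\<in>triangles n d. q ^ triangle_size n L) * (\<Sum>U\<in>triangles n d. q ^ triangle_size n U))"
    unfolding sum_product sum.cartesian_product
    by (simp add: power_add sum_distrib_left case_prod_unfold)
  finally show "(\<Sum>T\<in>RPP_diag n d. q ^ rpp_size n T)
       = q ^ (\<Sum>i<n. d i) * (vandermonde n (\<lambda>i. q ^ (d i + i)) / vandermonde n (\<lambda>i. q ^ i))\<^sup>2"
    by (simp add: tri power2_eq_square)
qed

text \<open>This is the source of \<open>2 * (n choose 3)\<close> and of the product of squares in
  the theorem. Each step of the recursion contributes \<open>qpoch q q n\<close> and
  \<open>q ^ (n choose 2)\<close> up to a sign that squaring removes, and the exponents add up by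
  Pascal's rule.\<close>

lemma vandermonde_power_square:
  fixes q :: real
  assumes q: "0 < q" "q < 1"
  shows "(vandermonde n (\<lambda>i. q ^ i))\<^sup>2 = q ^ (2 * (n choose 3)) * (\<Prod>j=1..n - 1. (qpoch q q j)\<^sup>2)"
proof (induction n)
  case 0
  then show ?case by (simp add: vandermonde_def numeral_3_eq_3)
next
  case (Suc n)
  have "vandermonde (Suc n) (\<lambda>i. q ^ i) = (-1) ^ n * (qpoch q q n * (\<Prod>i<n. q ^ i)) * vandermonde n (\<lambda>i. q ^ i)"
    using vandermonde_power_Suc[OF q, of n] qpoch_pos[OF q, of n]
    by (cases "even n") (auto simp: field_simps)
  then have "(vandermonde (Suc n) (\<lambda>i. q ^ i))\<^sup>2
      = (qpoch q q n)\<^sup>2 * ((\<Prod>i<n. q ^ i)\<^sup>2 * (vandermonde n (\<lambda>i. q ^ i))\<^sup>2)"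
    by (simp add: power_mult_distrib power_mult[symmetric] mult.commute[of n 2])
  also have "(\<Prod>i<n. q ^ i) = q ^ (n choose 2)"
    by (simp add: power_sum[symmetric] gauss_sum_nat lessThan_atLeast0 Sum_Ico_nat choose_two)
  also have "(q ^ (n choose 2))\<^sup>2 * (vandermonde n (\<lambda>i. q ^ i))\<^sup>2
      = q ^ (2 * (Suc n choose 3)) * (\<Prod>j=1..n - 1. (qpoch q q j)\<^sup>2)"
  proof -
    have "2 * (Suc n choose 3) = (n choose 2) * 2 + 2 * (n choose 3)"
      by (simp add: numeral_3_eq_3 numeral_2_eq_2)
    then show ?thesis
      by (simp add: Suc.IH power_mult[symmetric] power_add)
  qed
  also have "(qpoch q q n)\<^sup>2 * (q ^ (2 * (Suc n choose 3)) * (\<Prod>j=1..n - 1. (qpoch q q j)\<^sup>2))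
      = q ^ (2 * (Suc n choose 3)) * (\<Prod>j=1..Suc n - 1. (qpoch q q j)\<^sup>2)"
  \<comment> \<open>For \<open>n = 0\<close> the truncated \<open>n - 1\<close> leaves both products
    empty and the extra factor is \<open>qpoch q q 0 = 1\<close>; otherwise it is the new factor
    \<open>j = n\<close>.\<close>
  proof (cases n)
    case 0
    then show ?thesis by (simp add: qpoch_def)
  next
    case (Suc k)
    then show ?thesis by (simp add: mult_ac)
  qed
  finally show ?case .
qed

subsection \<open>Iterated Jackson integrals as sums\<close>

text \<open>These are the exponents of the lattice points \<open>q ^ v i\<close> of the simplex. As
  \<open>q < 1\<close>, increasing coordinates mean decreasing exponents, and the upper limit
  \<open>q ^ k\<close> becomes the lower bound \<open>k\<close>. The value 0 outside the range makes
  the encoding unique.\<close>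

definition antitone_seqs :: "nat \<Rightarrow> nat \<Rightarrow> (nat \<Rightarrow> nat) set" where
  "antitone_seqs n k = {v. (\<forall>i. i \<notin> {1..n} \<longrightarrow> v i = 0) \<and> (\<forall>i\<in>{1..n}. k \<le> v i) \<and>
     (\<forall>i j. 1 \<le> i \<and> i \<le> j \<and> j \<le> n \<longrightarrow> v j \<le> v i)}"

definition qpoint :: "real \<Rightarrow> nat \<Rightarrow> (nat \<Rightarrow> nat) \<Rightarrow> nat \<Rightarrow> real" where
  "qpoint q n v i = (if i \<in> {1..n} then q ^ v i else 0)"

text \<open>The last entry is the smallest exponent, hence the outermost variable, and it bounds all
  others from below. This mirrors the recursion of \<open>jackson_simplex\<close>.\<close>

lemma bij_betw_antitone_seqs_Suc:
  "bij_betw (\<lambda>(t, v). v(Suc n := k + t)) (SIGMA t:UNIV. antitone_seqs n (k + t)) (antitone_seqs (Suc n) k)"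
proof (rule bij_betw_byWitness[where f' = "\<lambda>v. (v (Suc n) - k, v(Suc n := 0))"])
  show "\<forall>v\<in>antitone_seqs (Suc n) k. (\<lambda>(t, v). v(Suc n := k + t)) (v (Suc n) - k, v(Suc n := 0)) = v"
    by (auto simp: antitone_seqs_def)
  show "(\<lambda>v. (v (Suc n) - k, v(Suc n := 0))) ` antitone_seqs (Suc n) k \<subseteq> (SIGMA t:UNIV. antitone_seqs n (k + t))"
    by (auto simp: antitone_seqs_def)
  show "(\<lambda>(t, v). v(Suc n := k + t)) ` (SIGMA t:UNIV. antitone_seqs n (k + t)) \<subseteq> antitone_seqs (Suc n) k"
  proof (rule image_subsetI)
    fix p assume "p \<in> (SIGMA t:UNIV. antitone_seqs n (k + t))"
    then obtain t v where p: "p = (t, v)" and v: "v \<in> antitone_seqs n (k + t)"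
      by blast
    from v have "k + t \<le> v i" "k \<le> v i" if "i \<in> {1..n}" for i
      using that by (auto simp: antitone_seqs_def dest: add_leD1)
    with v show "(\<lambda>(t, v). v(Suc n := k + t)) p \<in> antitone_seqs (Suc n) k"
      unfolding p by (auto simp: antitone_seqs_def le_Suc_eq)
  qed
qed (auto simp: antitone_seqs_def fun_eq_iff)

section \<open>Convergence: a dominating geometric series and bounded integrands\<close>

lemma summable_on_geometric_nat:
  fixes q :: real
  assumes "0 \<le> q" "q < 1"
  shows "(\<lambda>n::nat. q ^ n) summable_on UNIV"
  using assms by (intro norm_summable_imp_summable_on) (simp add: summable_geometric)

lemma summable_on_prod_geometric:
  fixes q :: real and n :: nat
  assumes q: "0 < q" "q < 1"
  shows "(\<lambda>v. \<Prod>i=1..n. q ^ v i) summable_on {v. \<forall>i. i \<notin> {1..n} \<longrightarrow> v i = (0::nat)}"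
proof (induction n)
  case 0
  have "{v. \<forall>i. i \<notin> {1..0::nat} \<longrightarrow> v i = (0::nat)} = {\<lambda>_. 0}" by auto
  then show ?case by simp
next
  case (Suc n)
  let ?S = "\<lambda>n. {v. \<forall>i. i \<notin> {1..n} \<longrightarrow> v i = (0::nat)}"
  have bij: "bij_betw (\<lambda>(t, v). v(Suc n := t)) (UNIV \<times> ?S n) (?S (Suc n))"
    by (rule bij_betw_byWitness[where f' = "\<lambda>v. (v (Suc n), v(Suc n := 0))"])
       (auto simp: fun_eq_iff)
  have "(\<lambda>(t, v). q ^ t * (\<Prod>i=1..n. q ^ v i)) summable_on (UNIV \<times> ?S n)"
  proof (rule summable_on_SigmaI[where g = "\<lambda>t. q ^ t * (\<Sum>\<^sub>\<infinity>v\<in>?S n. \<Prod>i=1..n. q ^ v i)"], goal_cases)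
    case (1 t)
    show ?case
      using has_sum_cmult_right[OF has_sum_infsum[OF Suc.IH], of "q ^ t"] by simp
  next
    case 2
    show ?case
      by (intro summable_on_cmult_left summable_on_geometric_nat) (use q in auto)
  next
    case (3 t v)
    then show ?case using q by (simp add: prod_nonneg)
  qed
  also have "?this \<longleftrightarrow> (\<lambda>p. (\<lambda>v. \<Prod>i=1..Suc n. q ^ v i) ((\<lambda>(t, v). v(Suc n := t)) p)) summable_on (UNIV \<times> ?S n)"
    by (intro summable_on_cong) (auto simp: mult.commute)
  also have "\<dots> \<longleftrightarrow> ?case"
    by (rule summable_on_reindex_bij_betw[OF bij])
  finally show ?case .
qed

text \<open>This is all that the convergence argument needs to know about an integrand. The cube
  contains every \<open>qpoint\<close>, including its zero coordinates, and fixing a coordinate to a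
  value in \<open>[0, 1]\<close> preserves the property.\<close>

definition bounded_on_cube :: "((nat \<Rightarrow> real) \<Rightarrow> real) \<Rightarrow> bool" where
  "bounded_on_cube f \<longleftrightarrow> (\<exists>B. \<forall>x. (\<forall>i. 0 \<le> x i \<and> x i \<le> 1) \<longrightarrow> \<bar>f x\<bar> \<le> B)"

lemma bounded_on_cube_const: "bounded_on_cube (\<lambda>_. c)"
  unfolding bounded_on_cube_def by blast

lemma bounded_on_cube_coord: "bounded_on_cube (\<lambda>x. x i)"
  unfolding bounded_on_cube_def by (intro exI[of _ 1]) auto

lemma bounded_on_cube_mult:
  assumes "bounded_on_cube f" "bounded_on_cube g"
  shows "bounded_on_cube (\<lambda>x. f x * g x)"
proof -
  from assms obtain B C where B: "\<And>x. (\<forall>i. 0 \<le> x i \<and> x i \<le> 1) \<Longrightarrow> \<bar>f x\<bar> \<le> B"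
    and C: "\<And>x. (\<forall>i. 0 \<le> x i \<and> x i \<le> 1) \<Longrightarrow> \<bar>g x\<bar> \<le> C"
    unfolding bounded_on_cube_def by blast
  show ?thesis
    unfolding bounded_on_cube_def
  proof (intro exI[of _ "B * C"] allI impI)
    fix x :: "nat \<Rightarrow> real" assume x: "\<forall>i. 0 \<le> x i \<and> x i \<le> 1"
    have "0 \<le> B" using B[OF x] by linarith
    then show "\<bar>f x * g x\<bar> \<le> B * C"
      unfolding abs_mult by (intro mult_mono B[OF x] C[OF x]) auto
  qed
qed

lemma bounded_on_cube_diff:
  assumes "bounded_on_cube f" "bounded_on_cube g"
  shows "bounded_on_cube (\<lambda>x. f x - g x)"
proof -
  from assms obtain B C where B: "\<And>x. (\<forall>i. 0 \<le> x i \<and> x i \<le> 1) \<Longrightarrow> \<bar>f x\<bar> \<le> B"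
    and C: "\<And>x. (\<forall>i. 0 \<le> x i \<and> x i \<le> 1) \<Longrightarrow> \<bar>g x\<bar> \<le> C"
    unfolding bounded_on_cube_def by blast
  show ?thesis
    unfolding bounded_on_cube_def
    by (intro exI[of _ "B + C"] allI impI) (use B C in \<open>smt (verit)\<close>)
qed

lemma bounded_on_cube_prod:
  assumes "\<And>a. a \<in> A \<Longrightarrow> bounded_on_cube (f a)"
  shows "bounded_on_cube (\<lambda>x. \<Prod>a\<in>A. f a x)"
  using assms
  by (induction A rule: infinite_finite_induct) (auto intro: bounded_on_cube_const bounded_on_cube_mult)

lemma bounded_on_cube_power:
  assumes "bounded_on_cube f"
  shows "bounded_on_cube (\<lambda>x. f x ^ k)"
  by (induction k) (auto intro: bounded_on_cube_const bounded_on_cube_mult assms)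

text \<open>In homogenised form the integrand is a polynomial in the coordinates, so the closure
  rules apply without division.\<close>

lemma bounded_on_cube_selberg_integrand: "bounded_on_cube (selberg_integrand q n a b m)"
  unfolding selberg_integrand_def qpoch_def hom_qpoch_def Delta_bar_def
  by (intro bounded_on_cube_mult bounded_on_cube_prod bounded_on_cube_diff bounded_on_cube_power
      bounded_on_cube_const bounded_on_cube_coord)

text \<open>Induction on the dimension, peeling off the outermost variable. The upper limit
  \<open>q ^ k\<close> and the integrand must be general, since the inner integral has the value of
  that variable as its limit and as a parameter.\<close>

lemma has_sum_jackson_simplex:
  assumes q: "0 < q" "q < 1" and f: "bounded_on_cube f"
  shows "((\<lambda>v. (1 - q) ^ n * (f (qpoint q n v) * (\<Prod>i=1..n. q ^ v i)))
           has_sum jackson_simplex q n (q ^ k) f) (antitone_seqs n k)"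
  using f
proof (induction n arbitrary: f k)
  case 0
  have "antitone_seqs 0 k = {\<lambda>_. 0}"
    by (auto simp: antitone_seqs_def)
  moreover have "qpoint q 0 (\<lambda>_. 0) = (\<lambda>_. 0)"
    by (auto simp: qpoint_def)
  ultimately show ?case
    using has_sum_finite[of "{\<lambda>_::nat. 0::nat}" "\<lambda>v. f (qpoint q 0 v)"] by simp
next
  case (Suc n)
  let ?F = "\<lambda>v. (1 - q) ^ Suc n * (f (qpoint q (Suc n) v) * (\<Prod>i=1..Suc n. q ^ v i))"
  let ?J = "\<lambda>t. jackson_simplex q n (q ^ (k + t)) (\<lambda>x. f (x(Suc n := q ^ (k + t))))"
  note bij = bij_betw_antitone_seqs_Suc[of n k]
  obtain B where B: "\<And>x. (\<forall>i. 0 \<le> x i \<and> x i \<le> 1) \<Longrightarrow> \<bar>f x\<bar> \<le> B"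
    using Suc.prems unfolding bounded_on_cube_def by blast
  have q01: "0 \<le> q ^ j" "q ^ j \<le> 1" for j
    using q by (auto intro: power_le_one)
  \<comment> \<open>Summability of the whole family comes first, by comparison with \<open>B\<close>
    times the product of geometric series; it justifies the regrouping by the last entry
    below.\<close>
  have "?F summable_on antitone_seqs (Suc n) k"
  proof (rule Infinite_Sum.abs_summable_summable, rule Infinite_Sum.abs_summable_on_comparison_test')
    show "(\<lambda>v. (1 - q) ^ Suc n * (B * (\<Prod>i=1..Suc n. q ^ v i))) summable_on antitone_seqs (Suc n) k"
      by (intro summable_on_cmult_right summable_on_subset[OF summable_on_prod_geometric[OF q]])
         (auto simp: antitone_seqs_def)
    fix v
    have "\<bar>f (qpoint q (Suc n) v)\<bar> \<le> B"
      by (rule B) (use q01 in \<open>auto simp: qpoint_def\<close>)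
    then show "norm (?F v) \<le> (1 - q) ^ Suc n * (B * (\<Prod>i=1..Suc n. q ^ v i))"
      unfolding real_norm_def abs_mult using q
      by (auto simp: abs_prod power_abs intro!: mult_mono mult_nonneg_nonneg prod_nonneg)
  qed
  then have summ: "(\<lambda>(t, w). ?F (w(Suc n := k + t))) summable_on (SIGMA t:UNIV. antitone_seqs n (k + t))"
    by (subst (asm) summable_on_reindex_bij_betw[OF bij, symmetric]) (simp add: case_prod_unfold)
  have inner: "((\<lambda>w. ?F (w(Suc n := k + t))) has_sum (1 - q) * (?J t * q ^ (k + t))) (antitone_seqs n (k + t))" for t
  proof -
    have "bounded_on_cube (\<lambda>x. f (x(Suc n := q ^ (k + t))))"
      unfolding bounded_on_cube_def
    proof (intro exI[of _ B] allI impI)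
      fix x :: "nat \<Rightarrow> real" assume "\<forall>i. 0 \<le> x i \<and> x i \<le> 1"
      then show "\<bar>f (x(Suc n := q ^ (k + t)))\<bar> \<le> B"
        by (intro B) (use q01 in auto)
    qed
    from has_sum_cmult_right[OF Suc.IH[OF this, of "k + t"], of "(1 - q) * q ^ (k + t)"]
    have "((\<lambda>w. (1 - q) * q ^ (k + t) * ((1 - q) ^ n * (f ((qpoint q n w)(Suc n := q ^ (k + t))) * (\<Prod>i=1..n. q ^ w i))))
        has_sum (1 - q) * q ^ (k + t) * ?J t) (antitone_seqs n (k + t))" .
    moreover have "?F (w(Suc n := k + t))
        = (1 - q) * q ^ (k + t) * ((1 - q) ^ n * (f ((qpoint q n w)(Suc n := q ^ (k + t))) * (\<Prod>i=1..n. q ^ w i)))" for w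
    proof -
      have "qpoint q (Suc n) (w(Suc n := k + t)) = (qpoint q n w)(Suc n := q ^ (k + t))"
        by (auto simp: qpoint_def fun_eq_iff)
      moreover have "(\<Prod>i=1..Suc n. q ^ (w(Suc n := k + t)) i) = (\<Prod>i=1..n. q ^ w i) * q ^ (k + t)"
        by simp
      ultimately show ?thesis by (simp only: power_Suc mult_ac)
    qed
    ultimately show ?thesis by (simp only: mult_ac)
  qed
  define S where "S = infsum (\<lambda>(t, w). ?F (w(Suc n := k + t))) (SIGMA t:UNIV. antitone_seqs n (k + t))"
  have total: "((\<lambda>(t, w). ?F (w(Suc n := k + t))) has_sum S) (SIGMA t:UNIV. antitone_seqs n (k + t))"
    unfolding S_def using summ by (rule has_sum_infsum)
  have "((\<lambda>t. (1 - q) * (?J t * q ^ (k + t))) has_sum S) UNIV"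
    by (rule has_sum_SigmaD[OF total]) (use inner in simp)
  then have "(\<lambda>t. (1 - q) * (?J t * q ^ (k + t))) sums S"
    by (rule has_sum_imp_sums)
  then have "(\<lambda>t. ?J t * q ^ (k + t)) sums (S / (1 - q))"
    using q sums_mult[of "\<lambda>t. (1 - q) * (?J t * q ^ (k + t))" S "1 / (1 - q)"] by simp
  \<comment> \<open>The terms of the Jackson integral at the lower endpoint vanish because they
    carry the factor \<open>0 * q ^ i\<close>.\<close>
  then have "jackson_simplex q (Suc n) (q ^ k) f = S"
    using q by (simp add: jackson_integral_def power_add[symmetric] sums_unique[symmetric])
  moreover have "(?F has_sum S) (antitone_seqs (Suc n) k)"
    using total by (subst has_sum_reindex_bij_betw[OF bij, symmetric]) (simp add: case_prod_unfold)
  ultimately show ?case by simp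
qed

subsection \<open>Summation over the diagonal\<close>

lemma prod_pairs_reverse:
  fixes g :: "nat \<Rightarrow> nat \<Rightarrow> 'a::comm_monoid_mult"
  shows "(\<Prod>i<n. \<Prod>j\<in>{i<..<n}. g (n - j) (n - i)) = (\<Prod>i=1..n. \<Prod>j\<in>{i<..n}. g i j)"
proof -
  have "(\<Prod>i<n. \<Prod>j\<in>{i<..<n}. g (n - j) (n - i))
      = (\<Prod>(i,j)\<in>(SIGMA i:{..<n}. {i<..<n}). g (n - j) (n - i))"
    by (rule prod.Sigma) auto
  also have "\<dots> = (\<Prod>(i,j)\<in>(SIGMA i:{1..n}. {i<..n}). g i j)"
    by (rule prod.reindex_bij_witness[where i = "\<lambda>(i,j). (n - j, n - i)" and j = "\<lambda>(i,j). (n - j, n - i)"])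
       auto
  also have "\<dots> = (\<Prod>i=1..n. \<Prod>j\<in>{i<..n}. g i j)"
    by (rule prod.Sigma[symmetric]) auto
  finally show ?thesis .
qed

lemma sum_reverse_atLeast1AtMost:
  fixes g :: "nat \<Rightarrow> 'a::comm_monoid_add"
  shows "(\<Sum>i<n. g (n - i)) = (\<Sum>i=1..n. g i)"
  by (rule sum.reindex_bij_witness[where i = "\<lambda>i. n - i" and j = "\<lambda>i. n - i"]) auto

text \<open>Matrix indices run from 0 with increasing exponents, diagonal indices from 1 with
  decreasing ones. The reversal flips the sign of every difference, which squaring hides.\<close>

lemma vandermonde_reverse_square:
  fixes x :: "nat \<Rightarrow> real"
  shows "(vandermonde n (\<lambda>i. x (n - i)))\<^sup>2 = (Delta_bar n x)\<^sup>2"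
proof -
  have "(vandermonde n (\<lambda>i. x (n - i)))\<^sup>2 = (\<Prod>i<n. \<Prod>j\<in>{i<..<n}. (x (n - i) - x (n - j))\<^sup>2)"
    by (simp add: vandermonde_def prod_power_distrib power2_commute)
  also have "\<dots> = (\<Prod>i=1..n. \<Prod>j\<in>{i<..n}. (x j - x i)\<^sup>2)"
    by (rule prod_pairs_reverse)
  finally show ?thesis
    by (simp add: Delta_bar_def prod_power_distrib)
qed

lemma hom_qpoch_power:
  assumes "0 < q"
  shows "hom_qpoch q m (q ^ r) (q ^ s)
    = (q ^ s) ^ (2 * m - 1) * qpoch q (q powi (1 - int m + int r - int s)) (2 * m - 1)"
proof -
  have combine: "q ^ s * (q powi e * q ^ l) = q powi (int s + (e + int l))" for e l
    using assms by (simp add: power_int_add)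
  have "q ^ s - q powi (1 - int m + int l) * q ^ r
      = q ^ s * (1 - q powi (1 - int m + int r - int s) * q ^ l)" for l
  proof -
    have "q ^ s * (q powi (1 - int m + int r - int s) * q ^ l)
        = q powi (int s + ((1 - int m + int r - int s) + int l))"
      by (rule combine)
    also have "\<dots> = q powi ((1 - int m + int l) + int r)"
      by (simp add: algebra_simps)
    also have "\<dots> = q powi (1 - int m + int l) * q ^ r"
      using assms by (simp add: power_int_add)
    finally show ?thesis by (simp add: right_diff_distrib)
  qed
  then show ?thesis
    by (simp add: hom_qpoch_def qpoch_def prod.distrib)
qed

lemma selberg_integrand_qpoint:
  "selberg_integrand q n a b m (qpoint q n v) = selberg_integrand q n a b m (\<lambda>i. q ^ v i)"
proof -
  have "Delta_bar n (qpoint q n v) = Delta_bar n (\<lambda>i. q ^ v i)"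
    unfolding Delta_bar_def qpoint_def by (intro prod.cong) auto
  then show ?thesis
    unfolding selberg_integrand_def qpoint_def by (auto intro!: prod.cong arg_cong2[of _ _ _ _ "(*)"])
qed

text \<open>The cut-off makes this an element of \<open>antitone_seqs\<close>:
  \<open>vdiag n T 0\<close> contains the summand \<open>n\<close>.\<close>

definition vseq :: "nat \<Rightarrow> (nat \<Rightarrow> nat \<Rightarrow> nat) \<Rightarrow> nat \<Rightarrow> nat" where
  "vseq n T i = (if i \<in> {1..n} then vdiag n T i else 0)"

text \<open>The part of the weight that is constant on arrays with the same diagonal;
  \<open>v i - (n - i)\<close> recovers the diagonal entry from its shifted form.\<close>

definition diag_wt :: "real \<Rightarrow> nat \<Rightarrow> nat \<Rightarrow> nat \<Rightarrow> nat \<Rightarrow> (nat \<Rightarrow> nat) \<Rightarrow> real" where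
  "diag_wt q n a b m v =
     q ^ (a * (\<Sum>i=1..n. v i - (n - i))) *
     (\<Prod>i=1..n. qpoch q (q ^ (v i + 1)) b) *
     (\<Prod>i=1..n. \<Prod>j\<in>{i<..n}. hom_qpoch q m (q ^ v i) (q ^ v j) / (q ^ v j - q ^ v i))"

lemma rpp_wt_eq:
  assumes "0 < q"
  shows "rpp_wt q n a b m T = q ^ rpp_size n T * diag_wt q n a b m (vseq n T)"
proof -
  have "rpp_trace n T = (\<Sum>i=1..n. rdiag n T i)"
    unfolding rpp_trace_def rdiag_def
    by (rule sum.reindex_bij_witness[where i = "\<lambda>i. n + 1 - i" and j = "\<lambda>i. n + 1 - i"]) auto
  then have "rpp_trace n T = (\<Sum>i=1..n. vseq n T i - (n - i))"
    by (simp add: vseq_def vdiag_def)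
  then show ?thesis
    unfolding rpp_wt_def diag_wt_def Let_def hom_qpoch_power[OF assms]
    by (simp add: power_add vseq_def)
qed

lemma rpp_diag_mono:
  assumes "T \<in> RPP n" "1 \<le> i" "i \<le> j" "j \<le> n"
  shows "T i i \<le> T j j"
proof -
  have "T i i \<le> T i j" "T i j \<le> T j j"
    using assms by (auto simp: RPP_def mono_on_def)
  then show ?thesis by simp
qed

lemma vseq_strict:
  assumes "T \<in> RPP n" "1 \<le> i" "i < j" "j \<le> n"
  shows "vseq n T j < vseq n T i"
proof -
  have "rdiag n T j \<le> rdiag n T i"
    unfolding rdiag_def by (rule rpp_diag_mono[OF assms(1)]) (use assms in auto)
  moreover have "vseq n T i = rdiag n T i + (n - i)" "vseq n T j = rdiag n T j + (n - j)"
    using assms by (auto simp: vseq_def vdiag_def)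
  ultimately show ?thesis using assms by linarith
qed

lemma vseq_in_antitone_seqs:
  assumes "T \<in> RPP n"
  shows "vseq n T \<in> antitone_seqs n 0"
proof -
  have "vseq n T j \<le> vseq n T i" if "1 \<le> i" "i \<le> j" "j \<le> n" for i j
    using vseq_strict[OF assms that(1), of j] that by (cases "i = j") auto
  then show ?thesis
    by (auto simp: antitone_seqs_def vseq_def)
qed

text \<open>Counted from 0, the diagonal entry at position \<open>i\<close> is \<open>rdiag\<close>
  at index \<open>n - i\<close>, whose shift is \<open>i\<close>. The lower bound on
  \<open>v\<close> keeps the subtraction from being truncated.\<close>

lemma RPP_fibre_eq_RPP_diag:
  assumes v: "\<And>i. i \<notin> {1..n} \<Longrightarrow> v i = 0" and ge: "\<And>i. i \<in> {1..n} \<Longrightarrow> n - i \<le> v i"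
  shows "{T \<in> RPP n. vseq n T = v} = RPP_diag n (\<lambda>i. v (n - i) - i)"
proof -
  have "vseq n T = v \<longleftrightarrow> (\<forall>i<n. T (Suc i) (Suc i) = v (n - i) - i)" for T
  proof
    assume "vseq n T = v"
    then show "\<forall>i<n. T (Suc i) (Suc i) = v (n - i) - i"
      by (auto simp: vseq_def vdiag_def rdiag_def Suc_diff_le)
  next
    assume T: "\<forall>i<n. T (Suc i) (Suc i) = v (n - i) - i"
    have "vseq n T i = v i" for i
    proof (cases "i \<in> {1..n}")
      case True
      then have "T (Suc (n - i)) (Suc (n - i)) = v (n - (n - i)) - (n - i)"
        using T by auto
      then show ?thesis
        using True ge[OF True] by (simp add: vseq_def vdiag_def rdiag_def Suc_diff_le)
    next
      case False
      then show ?thesis using v[OF False] by (auto simp: vseq_def)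
    qed
    then show "vseq n T = v" by blast
  qed
  then show ?thesis by (auto simp: RPP_diag_def)
qed

definition selberg_factor :: "real \<Rightarrow> nat \<Rightarrow> nat \<Rightarrow> real" where
  "selberg_factor q n a = q powi ((- 1 - int a) * int (n choose 2) - 2 * int (n choose 3)) /
              ((1 - q) ^ n * (\<Prod>j=1..n - 1. (qpoch q q j)\<^sup>2))"

text \<open>The theorem holds term by term: the arrays with shifted diagonal \<open>v\<close>
  together account for exactly the Jackson term at the point with exponents
  \<open>v\<close>.\<close>

lemma sum_RPP_fibre:
  fixes q :: real
  assumes q: "0 < q" "q < 1" and v: "v \<in> antitone_seqs n 0"
  shows "finite {T \<in> RPP n. vseq n T = v}"
    and "(\<Sum>T | T \<in> RPP n \<and> vseq n T = v. q ^ rpp_size n T) * diag_wt q n a b m v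
      = selberg_factor q n a *
        ((1 - q) ^ n * (selberg_integrand q n a b m (qpoint q n v) * (\<Prod>i=1..n. q ^ v i)))"
    (is "?sum = ?integral")
proof -
  let ?x = "\<lambda>i. q ^ v i"
  have "finite {T \<in> RPP n. vseq n T = v} \<and> ?sum = ?integral"
  \<comment> \<open>If two entries coincide, both sides are 0: no array has such a shifted diagonal,
    and \<open>Delta_bar\<close> vanishes at the point.\<close>
  proof (cases "\<exists>i j. 1 \<le> i \<and> i < j \<and> j \<le> n \<and> v i = v j")
    case True
    then obtain i j where ij: "1 \<le> i" "i < j" "j \<le> n" "v i = v j" by blast
    have empty: "{T \<in> RPP n. vseq n T = v} = {}"
      using vseq_strict[OF _ ij(1-3)] ij(4) by fastforce
    have row: "(\<Prod>j\<in>{i<..n}. ?x j - ?x i) = 0"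
      using ij by (intro prod_zero bexI[of _ j]) auto
    have "Delta_bar n ?x = 0"
      unfolding Delta_bar_def by (intro prod_zero bexI[of _ i] row) (use ij in auto)
    then have "selberg_integrand q n a b m ?x = 0"
      by (simp add: selberg_integrand_def)
    then show ?thesis
      unfolding empty by (simp add: selberg_integrand_qpoint)
  next
    case False
    have strict: "v j < v i" if "1 \<le> i" "i < j" "j \<le> n" for i j
    proof -
      have "v j \<le> v i" using v that by (auto simp: antitone_seqs_def)
      moreover have "v i \<noteq> v j" using False that by blast
      ultimately show ?thesis by simp
    qed
    \<comment> \<open>Going back from index \<open>n\<close>, strictly increasing naturals gain at
      least one per step, so \<open>v (n - i) - i\<close> is an exact difference.\<close>
    have ge': "i \<le> v (n - i)" if "i < n" for i
      using that
    proof (induction i)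
      case (Suc i)
      then have "v (n - i) < v (n - Suc i)" by (intro strict) auto
      with Suc show ?case by simp
    qed simp
    have ge: "n - i \<le> v i" if "i \<in> {1..n}" for i
      using ge'[of "n - i"] that by auto
    let ?d = "\<lambda>i. v (n - i) - i"
    have fibre: "{T \<in> RPP n. vseq n T = v} = RPP_diag n ?d"
      by (rule RPP_fibre_eq_RPP_diag) (use v ge in \<open>auto simp: antitone_seqs_def\<close>)
    have mono: "?d i \<le> ?d (Suc i)" if "Suc i < n" for i
    proof -
      have "v (n - i) < v (n - Suc i)" using that by (intro strict) auto
      then show ?thesis by linarith
    qed
    note RPP_diag = sum_RPP_diag[of q n ?d, OF q mono]
    define D where "D = (\<Sum>i=1..n. v i - (n - i))"
    have D: "(\<Sum>i<n. ?d i) = D"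
    proof -
      have "(\<Sum>i<n. ?d i) = (\<Sum>i<n. (\<lambda>k. v k - (n - k)) (n - i))"
        by (intro sum.cong) auto
      also have "\<dots> = D"
        unfolding D_def by (rule sum_reverse_atLeast1AtMost)
      finally show ?thesis .
    qed
    have "D + (\<Sum>i=1..n. n - i) = (\<Sum>i=1..n. v i)"
      unfolding D_def sum.distrib[symmetric] by (intro sum.cong refl le_add_diff_inverse2 ge)
    moreover have "(\<Sum>i=1..n. n - i) = n choose 2"
    proof -
      have "(\<Sum>i=1..n. n - i) = (\<Sum>i<n. n - (n - i))"
        by (rule sum_reverse_atLeast1AtMost[symmetric])
      also have "\<dots> = (\<Sum>i<n. i)"
        by (intro sum.cong) auto
      finally show ?thesis
        by (simp add: lessThan_atLeast0 Sum_Ico_nat choose_two)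
    qed
    ultimately have sum_v: "D + (n choose 2) = (\<Sum>i=1..n. v i)" by simp
    have van: "(vandermonde n (\<lambda>i. q ^ (?d i + i)))\<^sup>2 = (Delta_bar n ?x)\<^sup>2"
    proof -
      have "vandermonde n (\<lambda>i. q ^ (?d i + i)) = vandermonde n (\<lambda>i. q ^ v (n - i))"
        unfolding vandermonde_def by (intro prod.cong) (use ge' in auto)
      then show ?thesis
        using vandermonde_reverse_square[of n ?x] by simp
    qed
    have Delta_nonzero: "Delta_bar n ?x \<noteq> 0"
    proof -
      have "?x i < ?x j" if "1 \<le> i" "i < j" "j \<le> n" for i j
        using strict[OF that] q by (intro power_strict_decreasing) auto
      then show ?thesis
        unfolding Delta_bar_def by (fastforce simp: prod_zero_iff)
    qed
    define H where "H = (\<Prod>i=1..n. \<Prod>j\<in>{i<..n}. hom_qpoch q m (?x i) (?x j))"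
    define Q where "Q = (\<Prod>i=1..n. qpoch q (q ^ (v i + 1)) b)"
    define P where "P = (\<Prod>j=1..n - 1. (qpoch q q j)\<^sup>2)"
    have wt: "diag_wt q n a b m v = q ^ (a * D) * Q * (H / Delta_bar n ?x)"
      by (simp add: diag_wt_def D_def Q_def H_def Delta_bar_def prod_dividef)
    have integrand: "selberg_integrand q n a b m ?x = q ^ (a * (\<Sum>i=1..n. v i)) * Q * H * Delta_bar n ?x"
      by (simp add: selberg_integrand_def Q_def H_def prod.distrib power_sum[symmetric]
          power_mult[symmetric] sum_distrib_left[symmetric] sum_distrib_right[symmetric] mult.commute)
    have sum: "(\<Sum>T | T \<in> RPP n \<and> vseq n T = v. q ^ rpp_size n T)
        = q ^ D * ((Delta_bar n ?x)\<^sup>2 / (q ^ (2 * (n choose 3)) * P))"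
      using fibre RPP_diag(2)
      by (simp add: D van power_divide vandermonde_power_square[OF q] P_def)
    \<comment> \<open>The sum of \<open>v\<close> exceeds the diagonal sum \<open>D\<close> by
      \<open>n choose 2\<close>. It occurs \<open>a\<close> times through the integrand and once
      through the Jackson measure, whence the coefficient \<open>- 1 - int a\<close>; the rest is
      the power in the squared Vandermonde denominator.\<close>
    have pow: "q powi ((- 1 - int a) * int (n choose 2) - 2 * int (n choose 3))
          * (q ^ (a * (\<Sum>i=1..n. v i)) * q ^ (\<Sum>i=1..n. v i)) = q ^ D * q ^ (a * D) / q ^ (2 * (n choose 3))"
    proof -
      have q_add: "q powi (i + j) = q powi i * q powi j"
        and q_diff: "q powi (i - j) = q powi i / q powi j" for i j
        using q by (simp_all add: power_int_add power_int_diff)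
      have "q powi ((- 1 - int a) * int (n choose 2) - 2 * int (n choose 3))
          * (q ^ (a * (\<Sum>i=1..n. v i)) * q ^ (\<Sum>i=1..n. v i))
        = q powi ((- 1 - int a) * int (n choose 2) - 2 * int (n choose 3)
            + (int (a * (\<Sum>i=1..n. v i)) + int (\<Sum>i=1..n. v i)))"
        by (simp only: power_int_of_nat[symmetric] q_add)
      also have "(- 1 - int a) * int (n choose 2) - 2 * int (n choose 3)
            + (int (a * (\<Sum>i=1..n. v i)) + int (\<Sum>i=1..n. v i))
         = int D + int (a * D) - int (2 * (n choose 3))"
        unfolding sum_v[symmetric] by (simp add: algebra_simps)
      also have "q powi \<dots> = q ^ D * q ^ (a * D) / q ^ (2 * (n choose 3))"
        by (simp only: power_int_of_nat[symmetric] q_add q_diff)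
      finally show ?thesis .
    qed
    have "selberg_factor q n a * ((1 - q) ^ n * (selberg_integrand q n a b m ?x * (\<Prod>i=1..n. ?x i)))
      = q powi ((- 1 - int a) * int (n choose 2) - 2 * int (n choose 3))
          * (q ^ (a * (\<Sum>i=1..n. v i)) * q ^ (\<Sum>i=1..n. v i)) * (Q * H * Delta_bar n ?x) / P"
      unfolding integrand selberg_factor_def P_def[symmetric] power_sum[symmetric]
      using q by simp
    also have "\<dots> = q ^ D * ((Delta_bar n ?x)\<^sup>2 / (q ^ (2 * (n choose 3)) * P)) * (q ^ (a * D) * Q * (H / Delta_bar n ?x))"
      unfolding pow using Delta_nonzero by (simp add: power2_eq_square)
    finally have "?sum = ?integral"
      unfolding selberg_integrand_qpoint sum wt by simp
    with fibre RPP_diag(1) show ?thesis by simp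
  qed
  then show "finite {T \<in> RPP n. vseq n T = v}" "?sum = ?integral"
    by auto
qed

theorem theorem8p19:
  fixes q :: real and n a b m :: nat
  assumes "0 < q" and "q < 1" and "n \<ge> 1" and "m \<ge> 1"
  shows "((\<lambda>T. rpp_wt q n a b m T) has_sum
           (q powi ((- 1 - int a) * int (n choose 2) - 2 * int (n choose 3)) /
              ((1 - q) ^ n * (\<Prod>j=1..n - 1. (qpoch q q j)\<^sup>2)) *
            jackson_simplex q n 1 (selberg_integrand q n a b m)))
         (RPP n)"
proof -
  note q = assms(1,2)
  let ?F = "\<lambda>v. {T \<in> RPP n. vseq n T = v}"
  let ?g = "\<lambda>v. selberg_factor q n a *
        ((1 - q) ^ n * (selberg_integrand q n a b m (qpoint q n v) * (\<Prod>i=1..n. q ^ v i)))"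
  let ?S = "selberg_factor q n a * jackson_simplex q n 1 (selberg_integrand q n a b m)"
  have g: "(?g has_sum ?S) (antitone_seqs n 0)"
  proof (rule has_sum_cmult_right)
    show "((\<lambda>v. (1 - q) ^ n * (selberg_integrand q n a b m (qpoint q n v) * (\<Prod>i=1..n. q ^ v i)))
        has_sum jackson_simplex q n 1 (selberg_integrand q n a b m)) (antitone_seqs n 0)"
      using has_sum_jackson_simplex[OF q bounded_on_cube_selberg_integrand[of q n a b m], of n 0]
      by simp
  qed
  have wt: "rpp_wt q n a b m T = q ^ rpp_size n T * diag_wt q n a b m v" if "T \<in> ?F v" for T v
    using that rpp_wt_eq[OF q(1)] by auto
  have inner: "((\<lambda>T. rpp_wt q n a b m T) has_sum ?g v) (?F v)" if v: "v \<in> antitone_seqs n 0" for v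
  proof (rule has_sum_finiteI[OF sum_RPP_fibre(1)[OF q v]])
    have "(\<Sum>T\<in>?F v. rpp_wt q n a b m T) = (\<Sum>T\<in>?F v. q ^ rpp_size n T) * diag_wt q n a b m v"
      unfolding sum_distrib_right by (intro sum.cong wt refl)
    then show "?g v = (\<Sum>T\<in>?F v. rpp_wt q n a b m T)"
      using sum_RPP_fibre(2)[OF q v] by simp
  qed
  \<comment> \<open>Apart from a positive power of \<open>q\<close>, the weight depends only on
    \<open>v\<close>, so it has constant sign on a fibre and absolute values pass through the
    sum.\<close>
  have inner_abs: "((\<lambda>T. \<bar>rpp_wt q n a b m T\<bar>) has_sum \<bar>?g v\<bar>) (?F v)" if v: "v \<in> antitone_seqs n 0" for v
  proof (rule has_sum_finiteI[OF sum_RPP_fibre(1)[OF q v]])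
    have "(\<Sum>T\<in>?F v. \<bar>rpp_wt q n a b m T\<bar>) = (\<Sum>T\<in>?F v. q ^ rpp_size n T) * \<bar>diag_wt q n a b m v\<bar>"
      unfolding sum_distrib_right using q by (intro sum.cong refl) (simp add: wt abs_mult)
    also have "\<dots> = \<bar>(\<Sum>T\<in>?F v. q ^ rpp_size n T) * diag_wt q n a b m v\<bar>"
      using q by (simp add: abs_mult sum_nonneg)
    finally show "\<bar>?g v\<bar> = (\<Sum>T\<in>?F v. \<bar>rpp_wt q n a b m T\<bar>)"
      using sum_RPP_fibre(2)[OF q v] by simp
  qed
  \<comment> \<open>For unordered real sums summability is absolute, so the Jackson terms are
    absolutely summable. With the fibrewise absolute sums this gives summability over all pairs,
    which the regrouping needs.\<close>
  have "(\<lambda>(v, T). \<bar>rpp_wt q n a b m T\<bar>) summable_on (SIGMA v:antitone_seqs n 0. ?F v)"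
  proof (rule summable_on_SigmaI[where g = "\<lambda>v. \<bar>?g v\<bar>"], goal_cases)
    case (1 v)
    from inner_abs[OF this] show ?case by (simp only: prod.case)
  next
    case 2
    show ?case
      using has_sum_imp_summable[OF g, THEN summable_on_iff_abs_summable_on_real[THEN iffD1]]
      unfolding real_norm_def .
  next
    case (3 v T)
    show ?case by (simp only: prod.case abs_ge_zero)
  qed
  then have summable: "(\<lambda>(v, T). rpp_wt q n a b m T) summable_on (SIGMA v:antitone_seqs n 0. ?F v)"
    by (rule Infinite_Sum.abs_summable_summable[OF summable_on_cong[THEN iffD1, rotated]]) auto
  have "((\<lambda>(v, T). rpp_wt q n a b m T) has_sum ?S) (SIGMA v:antitone_seqs n 0. ?F v)"
    by (rule has_sum_SigmaI[OF _ g summable]) (simp only: prod.case inner)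
  \<comment> \<open>Each array lies in exactly one fibre, that of its own shifted diagonal.\<close>
  moreover have "bij_betw (\<lambda>T. (vseq n T, T)) (RPP n) (SIGMA v:antitone_seqs n 0. ?F v)"
    by (rule bij_betw_byWitness[where f' = snd]) (auto intro: vseq_in_antitone_seqs)
  ultimately have "((\<lambda>T. rpp_wt q n a b m T) has_sum ?S) (RPP n)"
    using has_sum_reindex_bij_betw[of "\<lambda>T. (vseq n T, T)" "RPP n" _ "\<lambda>(v, T). rpp_wt q n a b m T" ?S]
    by simp
  then show ?thesis
    by (simp add: selberg_factor_def)
qed

end
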